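(* Let $r\ge1$, $X=\{1,2,\ldots,r\}$, and let $g:X\to X\cup\{\infty\}$ be a map satisfying $g(y)>y$ for each $y\in X$. Then the statistic $\mathrm{stat}_g$ defined for $w=x_1\cdots x_n\in X^*$ by $$\mathrm{stat}_g(w)=\sum_{i=1}^{n-1} i\,\chi\big(x_i\ge g(x_{i+1})\big)+\sum_{1\le i<j\le n}\chi\big(g(x_j)>x_i>x_j\big)$$ is mahonian.
   Context: $X=\{1,\ldots,r\}$ with its natural order, extended to $X\cup\{\infty\}$ by letting $\infty$ be greater than every element of $X$. $X^*$ is the set of finite words with letters in $X$. $\chi(P)=1$ if $P$ is true and $0$ otherwise. For a sequence $\mathbf c=(c(1),\ldots,c(r))$ of non-negative integers, $\mathcal R(\mathbf c)$ is the set of all words obtained by permuting the letters of $1^{c(1)}2^{c(2)}\cdots r^{c(r)}$. A statistic $s$ on $X^*$ is mahonian if for every $\mathbf c$, $\sum_{w\in\mathcal R(\mathbf c)}q^{s(w)}=\sum_{w\in\mathcal R(\mathbf c)}q^{\mathrm{inv}(w)}$, where $\mathrm{inv}(w)=\sum_{i<j}\chi(x_i>x_j)$; equivalently, this sum is the $q$-multinomial coefficient $\frac{[c(1)+\cdots+c(r)]_q!}{[c(1)]_q!\cdots[c(r)]_q!}$. *)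

theory Defs
  imports
    "HOL-Library.Extended_Nat"
    "HOL-Combinatorics.Multiset_Permutations"
    "HOL-Computational_Algebra.Polynomial"
begin

(* Letters are natural numbers and words are lists. The ordered set consisting of 1, ..., r and a
   top element is the subset enat ` {1..r} \<union> {\<infinity>} of enat, with the order of enat. *)

definition rearrangements :: "nat \<Rightarrow> (nat \<Rightarrow> nat) \<Rightarrow> nat list set" where
  "rearrangements r c = permutations_of_multiset (\<Sum>k\<in>{1..r}. replicate_mset (c k) k)"

(* Lists are indexed from 0; this does not affect sums over pairs of positions. *)
definition word_inv :: "nat list \<Rightarrow> nat" where
  "word_inv w = (\<Sum>j<length w. \<Sum>i<j. of_bool (w ! i > w ! j))"

(* The generating functions are polynomials in an indeterminate q; monom 1 n is q ^ n. Only the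
   values of s on words over {1..r} matter. *)
definition mahonian :: "nat \<Rightarrow> (nat list \<Rightarrow> nat) \<Rightarrow> bool" where
  "mahonian r s \<longleftrightarrow>
     (\<forall>c :: nat \<Rightarrow> nat.
        (\<Sum>w\<in>rearrangements r c. monom (1 :: int) (s w)) =
        (\<Sum>w\<in>rearrangements r c. monom (1 :: int) (word_inv w)))"

(* In the first sum the positions i are counted from 1, so the i-th letter is w ! (i - 1). *)
definition stat :: "(nat \<Rightarrow> enat) \<Rightarrow> nat list \<Rightarrow> nat" where
  "stat g w =
     (\<Sum>i\<in>{1..<length w}. i * of_bool (enat (w ! (i - 1)) \<ge> g (w ! i))) +
     (\<Sum>j<length w. \<Sum>i<j. of_bool (g (w ! j) > enat (w ! i) \<and> w ! i > w ! j))"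

end

theory Submission
  imports Defs
begin

(* Foata's second fundamental transformation, with the comparison against the appended letter y
   replaced by the comparison against g y. The word is read from left to right. Before y is
   appended, the current word is cut after each letter lying on the same side of g y as its last
   letter, and in each block the final letter is moved to the front. The letters \<ge> g y are
   larger than all the others, so this changes the number of inversions by the total number of
   letters on the other side of g y, upwards or downwards, which is what turns inv into stat g. *)

text \<open>No block is formed explicitly: a letter failing \<open>P\<close> slips in behind the
  head of the transformed tail, which is the letter ending its block. The value \<open>[x]\<close>
  arises only when the last letter fails \<open>P\<close>, a case excluded wherever the block
  structure matters.\<close>

primrec move_front :: "('a \<Rightarrow> bool) \<Rightarrow> 'a list \<Rightarrow> 'a list" where
  "move_front P [] = []"
| "move_front P (x # xs) =
     (if P x then x # move_front P xs
      else (case move_front P xs of [] \<Rightarrow> [x] | y # ys \<Rightarrow> y # x # ys))"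

lemma mset_move_front [simp]: "mset (move_front P xs) = mset xs"
  by (induction xs) (auto split: list.split)

lemma move_front_eq_Nil_iff [simp]: "move_front P xs = [] \<longleftrightarrow> xs = []"
  by (metis mset_move_front mset_zero_iff)

lemma hd_move_front:
  assumes "xs \<noteq> []" "P (last xs)"
  shows "P (hd (move_front P xs))"
  using assms
  by (induction xs) (auto split: list.split if_splits)

text \<open>The second letter of the image, if there is one, reveals the branch taken: it fails
  \<open>P\<close> exactly when the first letter of the word does. So that letter can be recovered,
  and the tail follows by induction.\<close>

lemma move_front_inj:
  assumes "move_front P xs = move_front P ys"
    and "xs \<noteq> [] \<Longrightarrow> P (last xs)" "ys \<noteq> [] \<Longrightarrow> P (last ys)"
  shows "xs = ys"
  using assms
proof (induction xs arbitrary: ys)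
  case Nil
  then show ?case by (metis move_front_eq_Nil_iff)
next
  case (Cons x xs)
  then obtain y ys' where ys: "ys = y # ys'"
    by (metis list.exhaust move_front_eq_Nil_iff)
  have IH: "move_front P xs = move_front P ys' \<Longrightarrow> xs = ys'"
  proof (rule Cons.IH)
    show "P (last xs)" if "xs \<noteq> []" using Cons.prems(2) that by simp
    show "P (last ys')" if "ys' \<noteq> []" using Cons.prems(3) ys that by simp
  qed
  have hx: "P (hd (move_front P xs))" if "move_front P xs \<noteq> []"
    using hd_move_front[of xs P] Cons.prems that by auto
  have hy: "P (hd (move_front P ys'))" if "move_front P ys' \<noteq> []"
    using hd_move_front[of ys' P] Cons.prems ys that by auto
  \<comment> \<open>The last letter satisfies \<open>P\<close>, so a letter failing \<open>P\<close>
    is not the last one.\<close>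
  have nx: "move_front P xs \<noteq> []" if "\<not> P x" using Cons.prems that by auto
  have ny: "move_front P ys' \<noteq> []" if "\<not> P y" using Cons.prems ys that by auto
  show ?case
    using Cons.prems(1) IH hx hy nx ny unfolding ys
    by (cases "move_front P xs"; cases "move_front P ys'") (auto simp del: move_front_eq_Nil_iff split: if_splits)
qed

lemma length_filter_cong_mset:
  "mset xs = mset ys \<Longrightarrow> length (filter P xs) = length (filter P ys)"
  by (metis mset_filter size_mset)

lemma sum_of_bool_nth_eq_length_filter:
  "(\<Sum>i<length w. of_bool (P (w ! i))) = length (filter P w)"
  by (induction w rule: rev_induct) (auto simp: nth_append)

lemma word_inv_Nil [simp]: "word_inv [] = 0"
  by (simp add: word_inv_def)

lemma word_inv_snoc:
  "word_inv (w @ [y]) = word_inv w + length (filter (\<lambda>x. x > y) w)"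
  by (simp add: word_inv_def nth_append flip: sum_of_bool_nth_eq_length_filter)

text \<open>\<open>move_front\<close> recurses from the left while \<open>foata\<close> grows on the
  right; this is the left-hand recursion.\<close>

lemma word_inv_Cons:
  "word_inv (x # w) = word_inv w + length (filter (\<lambda>y. y < x) w)"
proof (induction w rule: rev_induct)
  case Nil
  show ?case by (simp add: word_inv_def)
next
  case (snoc y w)
  then show ?case
    using word_inv_snoc[of "x # w" y] word_inv_snoc[of w y] by simp
qed

text \<open>Each letter failing \<open>P\<close> is overtaken by exactly one letter, the larger one
  ending its block, and each overtaking creates one inversion.\<close>

lemma word_inv_move_front_large:
  assumes "\<And>x z. P x \<Longrightarrow> \<not> P z \<Longrightarrow> z < x"
    and "xs \<noteq> [] \<Longrightarrow> P (last xs)"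
  shows "word_inv (move_front P xs) = word_inv xs + length (filter (\<lambda>x. \<not> P x) xs)"
  using assms(2)
proof (induction xs)
  case (Cons x xs)
  have IH: "word_inv (move_front P xs) = word_inv xs + length (filter (\<lambda>x. \<not> P x) xs)"
    by (rule Cons.IH) (use Cons.prems in auto)
  have cnt: "length (filter (\<lambda>y. y < x) (move_front P xs)) = length (filter (\<lambda>y. y < x) xs)"
    by (rule length_filter_cong_mset) simp
  show ?case
  proof (cases "P x")
    case True
    then show ?thesis using IH cnt by (simp add: word_inv_Cons)
  next
    case False
    then have "xs \<noteq> []" "P (last xs)" using Cons.prems by (auto split: if_splits)
    then obtain b bs where b: "move_front P xs = b # bs" "P b"
      using hd_move_front[of xs P] by (cases "move_front P xs") auto
    then have "x < b" using assms(1) False by blast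
    then show ?thesis using IH cnt b False by (auto simp: word_inv_Cons)
  qed
qed simp

text \<open>Now the overtaking letter is the smaller one, so each overtaking removes an inversion.
  The count stands on the left to avoid truncated subtraction.\<close>

lemma word_inv_move_front_small:
  assumes "\<And>x z. P x \<Longrightarrow> \<not> P z \<Longrightarrow> x < z"
    and "xs \<noteq> [] \<Longrightarrow> P (last xs)"
  shows "word_inv (move_front P xs) + length (filter (\<lambda>x. \<not> P x) xs) = word_inv xs"
  using assms(2)
proof (induction xs)
  case (Cons x xs)
  have IH: "word_inv (move_front P xs) + length (filter (\<lambda>x. \<not> P x) xs) = word_inv xs"
    by (rule Cons.IH) (use Cons.prems in auto)
  have cnt: "length (filter (\<lambda>y. y < x) (move_front P xs)) = length (filter (\<lambda>y. y < x) xs)"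
    by (rule length_filter_cong_mset) simp
  show ?case
  proof (cases "P x")
    case True
    then show ?thesis using IH cnt by (simp add: word_inv_Cons)
  next
    case False
    then have "xs \<noteq> []" "P (last xs)" using Cons.prems by (auto split: if_splits)
    then obtain b bs where b: "move_front P xs = b # bs" "P b"
      using hd_move_front[of xs P] by (cases "move_front P xs") auto
    then have "b < x" using assms(1) False by blast
    then show ?thesis using IH cnt b False by (auto simp: word_inv_Cons)
  qed
qed simp

definition foata_step :: "('a \<Rightarrow> bool) \<Rightarrow> 'a list \<Rightarrow> 'a list" where
  "foata_step P v = (if P (last v) then move_front P v else move_front (\<lambda>x. \<not> P x) v)"

lemma mset_foata_step [simp]: "mset (foata_step P v) = mset v"
  by (simp add: foata_step_def)

text \<open>The head of the image shows which of the two predicates cut the word;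
  \<open>inj_foata_step\<close> relies on this.\<close>

lemma hd_foata_step:
  assumes "v \<noteq> []"
  shows "P (hd (foata_step P v)) \<longleftrightarrow> P (last v)"
  using assms hd_move_front[of v P] hd_move_front[of v "\<lambda>x. \<not> P x"]
  by (auto simp: foata_step_def)

lemma inj_foata_step: "inj (foata_step P)"
proof (rule injI)
  fix u v assume eq: "foata_step P u = foata_step P v"
  then have "mset u = mset v" by (metis mset_foata_step)
  then have "u = [] \<longleftrightarrow> v = []" by (metis mset_zero_iff)
  moreover have "P (last u) \<longleftrightarrow> P (last v)" if "u \<noteq> []" "v \<noteq> []"
    using that eq hd_foata_step by metis
  ultimately show "u = v"
    using eq move_front_inj[of P u v] move_front_inj[of "\<lambda>x. \<not> P x" u v]
    by (cases "u = []") (auto simp: foata_step_def split: if_splits)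
qed

text \<open>A gain equal to the number of letters failing \<open>P\<close> is
  \<open>length v\<close> minus the number satisfying it. In this form both cases subtract the same
  count, and \<open>length v\<close> is the weight of a descent in \<open>stat\<close>.\<close>

lemma word_inv_foata_step:
  assumes "\<And>x z. P x \<Longrightarrow> \<not> P z \<Longrightarrow> z < x" and "v \<noteq> []"
  shows "word_inv (foata_step P v) + length (filter P v) =
    word_inv v + (if P (last v) then length v else 0)"
proof (cases "P (last v)")
  case True
  then show ?thesis
    using word_inv_move_front_large[of P v] assms sum_length_filter_compl[of P v]
    by (simp add: foata_step_def)
next
  case False
  then show ?thesis
    using word_inv_move_front_small[of "\<lambda>x. \<not> P x" v] assms
    by (simp add: foata_step_def)
qed

(* The argument is the word read from right to left. *)
primrec foata_rev :: "(nat \<Rightarrow> enat) \<Rightarrow> nat list \<Rightarrow> nat list" where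
  "foata_rev g [] = []"
| "foata_rev g (y # xs) = foata_step (\<lambda>x. g y \<le> enat x) (foata_rev g xs) @ [y]"

definition foata :: "(nat \<Rightarrow> enat) \<Rightarrow> nat list \<Rightarrow> nat list" where
  "foata g w = foata_rev g (rev w)"

lemma foata_Nil [simp]: "foata g [] = []"
  by (simp add: foata_def)

lemma foata_snoc [simp]:
  "foata g (w @ [y]) = foata_step (\<lambda>x. g y \<le> enat x) (foata g w) @ [y]"
  by (simp add: foata_def)

lemma mset_foata [simp]: "mset (foata g w) = mset w"
  by (induction w rule: rev_induct) auto

lemma foata_eq_Nil_iff [simp]: "foata g w = [] \<longleftrightarrow> w = []"
  by (metis mset_foata mset_zero_iff)

lemma last_foata: "w \<noteq> [] \<Longrightarrow> last (foata g w) = last w"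
  by (cases w rule: rev_cases) auto

text \<open>The image keeps the last letter, which determines the predicate of the last step, so
  that step can be undone.\<close>

lemma inj_foata: "inj (foata g)"
proof (rule injI)
  show "u = v" if "foata g u = foata g v" for u v
    using that
  proof (induction u arbitrary: v rule: rev_induct)
    case Nil
    then show ?case by (metis foata_eq_Nil_iff)
  next
    case (snoc x u)
    then obtain v' y where "v = v' @ [y]"
      by (metis foata_eq_Nil_iff snoc_eq_iff_butlast)
    with snoc.prems have "x = y"
        "foata_step (\<lambda>z. g x \<le> enat z) (foata g u) = foata_step (\<lambda>z. g x \<le> enat z) (foata g v')"
      by auto
    then show ?case
      using snoc.IH injD[OF inj_foata_step] \<open>v = v' @ [y]\<close> by blast
  qed
qed

lemma stat_Nil [simp]: "stat g [] = 0"
  by (simp add: stat_def)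

lemma stat_snoc:
  assumes "w \<noteq> []"
  shows "stat g (w @ [y]) = stat g w + (if g y \<le> enat (last w) then length w else 0)
    + length (filter (\<lambda>x. enat x < g y \<and> y < x) w)"
proof -
  \<comment> \<open>\<open>u ! i\<close> is the letter in position i + 1, so \<open>d u i\<close> is
    the i-th term of the first sum of \<open>stat\<close>.\<close>
  define d where "d u i = i * of_bool (g (u ! i) \<le> enat (u ! (i - 1)))" for u :: "nat list" and i
  have "{1..<length (w @ [y])} = insert (length w) {1..<length w}"
    using assms by (auto simp: less_Suc_eq Suc_le_eq)
  then have "sum (d (w @ [y])) {1..<length (w @ [y])} =
      d (w @ [y]) (length w) + sum (d (w @ [y])) {1..<length w}"
    by simp
  moreover have "sum (d (w @ [y])) {1..<length w} = sum (d w) {1..<length w}"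
    by (intro sum.cong) (auto simp: d_def nth_append)
  moreover have "d (w @ [y]) (length w) = (if g y \<le> enat (last w) then length w else 0)"
    using assms by (simp add: d_def nth_append last_conv_nth)
  moreover have
    "(\<Sum>j<length (w @ [y]). \<Sum>i<j.
        of_bool (enat ((w @ [y]) ! i) < g ((w @ [y]) ! j) \<and> (w @ [y]) ! j < (w @ [y]) ! i)) =
     (\<Sum>j<length w. \<Sum>i<j. of_bool (enat (w ! i) < g (w ! j) \<and> w ! j < w ! i))
     + length (filter (\<lambda>x. enat x < g y \<and> y < x) w)"
    by (simp add: nth_append flip: sum_of_bool_nth_eq_length_filter)
  ultimately show ?thesis
    by (simp add: stat_def d_def)
qed

text \<open>Appending \<open>y\<close> adds an inversion for each letter above \<open>y\<close>. As
  \<open>y\<close> lies below \<open>g y\<close>, these include all letters \<ge>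
  \<open>g y\<close>, whose count the preceding step subtracted; what survives is the number of
  letters strictly between \<open>y\<close> and \<open>g y\<close>, plus the descent weight.\<close>

lemma word_inv_foata:
  assumes "\<And>y. y \<in> set w \<Longrightarrow> enat y < g y"
  shows "word_inv (foata g w) = stat g w"
  using assms
proof (induction w rule: rev_induct)
  case Nil
  show ?case by simp
next
  case (snoc y w)
  show ?case
  proof (cases "w = []")
    case True
    then show ?thesis by (simp add: foata_def foata_step_def word_inv_def stat_def)
  next
    case False
    let ?P = "\<lambda>x. g y \<le> enat x"
    let ?Q = "\<lambda>x. enat x < g y \<and> y < x"
    have gy: "enat y < g y" using snoc.prems by simp
    have IH: "word_inv (foata g w) = stat g w" using snoc by simp
    have step: "word_inv (foata_step ?P (foata g w)) + length (filter ?P (foata g w)) =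
        word_inv (foata g w) + (if ?P (last (foata g w)) then length (foata g w) else 0)"
    proof (rule word_inv_foata_step)
      show "z < x" if "?P x" "\<not> ?P z" for x z
        using that by (metis enat_ord_simps(2) less_le_trans not_le)
    qed (use False in simp)
    have len: "length (foata g w) = length w" by (metis mset_foata size_mset)
    have P: "length (filter ?P (foata g w)) = length (filter ?P w)"
      by (rule length_filter_cong_mset) simp
    have above: "length (filter (\<lambda>x. y < x) (foata_step ?P (foata g w))) =
        length (filter (\<lambda>x. y < x) w)"
      by (rule length_filter_cong_mset) simp
    have imp: "y < x" if "?P x" for x
      using gy that by (metis enat_ord_simps(2) less_le_trans)
    have split: "length (filter (\<lambda>x. y < x) w) = length (filter ?P w) + length (filter ?Q w)"
      for w
      by (induction w) (use imp in \<open>auto simp: not_le\<close>)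
    show ?thesis
      using step IH len P above split[of w] last_foata[OF False, of g]
      by (simp add: word_inv_snoc stat_snoc[OF False])
  qed
qed

text \<open>The letters are preserved and the class is finite, so injectivity suffices and no
  inverse is built.\<close>

lemma bij_betw_foata:
  "bij_betw (foata g) (permutations_of_multiset A) (permutations_of_multiset A)"
proof (rule bij_betw_imageI)
  show "inj_on (foata g) (permutations_of_multiset A)"
    using inj_foata by (rule inj_on_subset) simp
  then show "foata g ` permutations_of_multiset A = permutations_of_multiset A"
    by (intro endo_inj_surj finite_permutations_of_multiset)
      (auto simp: permutations_of_multiset_def)
qed

theorem corollary1p10:
  fixes r :: nat and g :: "nat \<Rightarrow> enat"
  assumes "r \<ge> 1"
    and "\<And>y. y \<in> {1..r} \<Longrightarrow> g y \<in> enat ` {1..r} \<union> {\<infinity>}"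
    and "\<And>y. y \<in> {1..r} \<Longrightarrow> g y > enat y"
  shows "mahonian r (stat g)"
  unfolding mahonian_def
proof
  fix c :: "nat \<Rightarrow> nat"
  let ?A = "\<Sum>k\<in>{1..r}. replicate_mset (c k) k"
  \<comment> \<open>The bound \<open>g y > enat y\<close> is assumed only on \<open>{1..r}\<close>,
    so the letters of a rearrangement must be shown to lie there.\<close>
  have "set_mset ?A \<subseteq> {1..r}"
    by (auto simp: set_mset_sum split: if_splits)
  moreover have "set w = set_mset ?A" if "w \<in> rearrangements r c" for w
    using permutations_of_multisetD[of w ?A] that unfolding rearrangements_def
    by (simp flip: set_mset_mset)
  ultimately have inv: "word_inv (foata g w) = stat g w" if "w \<in> rearrangements r c" for w
    using that assms(3) by (intro word_inv_foata) blast
  have "(\<Sum>w\<in>rearrangements r c. monom (1 :: int) (stat g w)) =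
      (\<Sum>w\<in>rearrangements r c. monom 1 (word_inv (foata g w)))"
    by (simp add: inv)
  also have "\<dots> = (\<Sum>w\<in>rearrangements r c. monom 1 (word_inv w))"
    unfolding rearrangements_def by (rule sum.reindex_bij_betw[OF bij_betw_foata])
  finally show "(\<Sum>w\<in>rearrangements r c. monom (1 :: int) (stat g w)) =
      (\<Sum>w\<in>rearrangements r c. monom 1 (word_inv w))" .
qed

end
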